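(* Let $k\in\mathbb{N}$ with $k\geq 2$ and let $n<\omega$. Let $G(\omega_n)=\bigoplus_{\sigma<\omega_n}\mathbb{Q}$. Then there is a colouring of $G(\omega_n)$ by $2^{4+n}\cdot 3^2$ colours such that there is no infinite subset $X$ of $G(\omega_n)$ for which $FS_k(X)\cup\{k\vec x:\vec x\in X\}$ is monochromatic. In particular, there is no infinite subset $X$ of $G(\omega_n)$ for which $kX=X+X+\cdots+X$ ($k$ times) is monochromatic.
   Context: $\omega_n$ is the $n$-th infinite cardinal ($\omega_0=\omega$). For a subset $X$ of an abelian group, $FS_k(X)=\{\sum F:F\subseteq X,\ |F|=k\}$ and $k\vec x$ is the $k$-fold multiple of $\vec x$; $kX$ is the $k$-fold sumset $\{x_1+\cdots+x_k:x_i\in X\}$. *)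

theory Defs
  imports Complex_Main "HOL-Library.Poly_Mapping" "HOL-Library.FuncSet"
begin

unbundle cardinal_syntax

text \<open>
  \<open>has_card_omega n A\<close> says that \<open>A\<close> has cardinality \<open>\<omega>\<^sub>n\<close>.  As \<^const>\<open>cardSuc\<close> raises the
  type, the cardinals \<open>\<omega>\<^sub>n\<close> cannot be defined by iterating it inside a single type; instead
  each stage is represented by some set of the given type.
\<close>

primrec has_card_omega :: "nat \<Rightarrow> 'a set \<Rightarrow> bool" where
  "has_card_omega 0 A \<longleftrightarrow> |A| =o natLeq"
| "has_card_omega (Suc n) A \<longleftrightarrow> (\<exists>B. has_card_omega n B \<and> |A| =o cardSuc |B| )"

text \<open>The direct sum of copies of the rationals indexed by \<open>I\<close>.\<close>

definition rat_direct_sum :: "'a set \<Rightarrow> ('a \<Rightarrow>\<^sub>0 rat) set" where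
  "rat_direct_sum I = {x. Poly_Mapping.keys x \<subseteq> I}"

definition FS :: "nat \<Rightarrow> 'g::ab_group_add set \<Rightarrow> 'g set" where
  "FS k X = {\<Sum>F | F. F \<subseteq> X \<and> finite F \<and> card F = k}"

definition multiple :: "nat \<Rightarrow> 'g::ab_group_add \<Rightarrow> 'g" where
  "multiple k x = (\<Sum>i<k. x)"

definition sumset :: "nat \<Rightarrow> 'g::ab_group_add set \<Rightarrow> 'g set" where
  "sumset k X = {(\<Sum>i<k. x i) | x :: nat \<Rightarrow> 'g. \<forall>i<k. x i \<in> X}"

definition monochromatic :: "('g \<Rightarrow> 'c) \<Rightarrow> 'g set \<Rightarrow> bool" where
  "monochromatic c S \<longleftrightarrow> (\<exists>j. \<forall>x\<in>S. c x = j)"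

end

theory Submission
  imports Defs
begin

text \<open>
  If \<open>s\<close> is the sum of \<open>k - 1\<close> elements of \<open>X\<close>, then \<open>y + s\<close> and \<open>k y\<close> have the same colour for all
  remaining \<open>y \<in> X\<close>, so it suffices that the colouring separates these two when \<open>y\<close> is large
  compared with \<open>s\<close>.

  For finitely many coordinates, exhaust the group by lattices \<open>L\<^sub>i\<close> such that \<open>k y \<in> L\<^sub>i\<close> or
  \<open>(k - 1) y \<in> L\<^sub>i\<close> implies \<open>y \<in> L\<^bsub>i+1\<^esub>\<close>. If \<open>X\<close> meets infinitely many levels, take \<open>y\<close> of level \<open>i + 2\<close>
  with \<open>s \<in> L\<^sub>i\<close>: then \<open>y + s\<close> agrees with \<open>y\<close> modulo \<open>L\<^sub>i\<close>, while \<open>k y\<close> either drops exactly one level,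
  which the parity of the level detects, or stays at the same level but differs from \<open>y\<close> modulo
  \<open>L\<^sub>i\<close>, which a 3-colouring of the graph of multiplication by \<open>k\<close> modulo \<open>L\<^sub>i\<close> detects. Otherwise
  \<open>X\<close> lies in one lattice and has unbounded norm, and \<open>log\<^sub>k\<close> of the norm modulo 2 (in
  half-integer steps) separates \<open>y + s\<close> from \<open>k y\<close>. This takes 24 colours.

  Each further cardinal costs a factor 2. Order the coordinates so that initial segments are
  smaller, and colour \<open>x\<close> by the colouring belonging to its largest coordinate \<open>\<sigma> x\<close>, together with the
  parity of \<open>log\<^sub>k\<close> of the coefficient there. If \<open>\<sigma>\<close> takes infinitely many values on \<open>X\<close>, the parity
  separates a sum from \<open>k\<close> times its leading summand; otherwise \<open>\<sigma>\<close> and the sign of the leading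
  coefficient are constant on an infinite subset of \<open>X\<close>, whose sums then have the same \<open>\<sigma>\<close> too.
\<close>

subsection \<open>Sums and multiples\<close>

abbreviation coord :: "('a \<Rightarrow>\<^sub>0 rat) \<Rightarrow> 'a \<Rightarrow> rat" where
  "coord \<equiv> Poly_Mapping.lookup"

text \<open>Only the statement about \<open>FS k X\<close> and the multiples is carried through the
  induction. Both sets lie in \<open>sumset k X\<close>, so the statement about sumsets follows at
  the end.\<close>

definition good :: "nat \<Rightarrow> 'a set \<Rightarrow> nat \<Rightarrow> bool" where
  "good k J N \<longleftrightarrow> (\<exists>c \<in> rat_direct_sum J \<rightarrow> {..<N}.
    \<forall>X. X \<subseteq> rat_direct_sum J \<longrightarrow> infinite X \<longrightarrow> \<not> monochromatic c (FS k X \<union> multiple k ` X))"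

lemma good_mono:
  assumes "good k J M" "M \<le> N"
  shows "good k J N"
proof -
  have "rat_direct_sum J \<rightarrow> {..<M} \<subseteq> rat_direct_sum J \<rightarrow> {..<N}"
    using assms(2) by (intro Pi_mono) auto
  then show ?thesis
    using assms(1) unfolding good_def by (meson subsetD)
qed

lemma lookup_multiple: "coord (multiple k x) j = of_nat k * coord (x :: 'a \<Rightarrow>\<^sub>0 rat) j"
  by (simp add: multiple_def lookup_sum)

lemma rat_direct_sum_iff: "x \<in> rat_direct_sum J \<longleftrightarrow> (\<forall>j. j \<notin> J \<longrightarrow> coord x j = 0)"
  by (auto simp: rat_direct_sum_def in_keys_iff)

lemma FS_subset_sumset: "FS k X \<subseteq> sumset k X"
proof
  fix z assume "z \<in> FS k X"
  then obtain F where F: "F \<subseteq> X" "finite F" "card F = k" "z = \<Sum>F"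
    by (auto simp: FS_def)
  obtain h where h: "bij_betw h {..<k} F"
    using ex_bij_betw_nat_finite[OF F(2)] F(3) by (auto simp: atLeast0LessThan)
  have "z = (\<Sum>i<k. h i)"
    using sum.reindex_bij_betw[OF h, of "\<lambda>x. x"] F(4) by simp
  moreover have "\<forall>i<k. h i \<in> X"
    using bij_betwE[OF h] F(1) by blast
  ultimately show "z \<in> sumset k X"
    unfolding sumset_def by blast
qed

lemma multiple_subset_sumset: "multiple k ` X \<subseteq> sumset k X"
proof
  fix z assume "z \<in> multiple k ` X"
  then obtain x where "x \<in> X" "z = (\<Sum>i<k. (\<lambda>_. x) i)"
    by (auto simp: multiple_def)
  then show "z \<in> sumset k X"
    unfolding sumset_def by blast
qed

lemma monochromatic_subset: "monochromatic c S \<Longrightarrow> T \<subseteq> S \<Longrightarrow> monochromatic c T"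
  unfolding monochromatic_def by blast

lemma FS_mono: "X \<subseteq> Y \<Longrightarrow> FS k X \<subseteq> FS k Y"
  unfolding FS_def by blast

lemma multiple_in_rat_direct_sum: "x \<in> rat_direct_sum J \<Longrightarrow> multiple k x \<in> rat_direct_sum J"
  by (auto simp: rat_direct_sum_iff lookup_multiple)

text \<open>With \<open>T\<close> fixed and \<open>y\<close> varying, this supplies the sums whose
  colour is compared with that of \<open>multiple k y\<close>.\<close>

lemma add_sum_in_FS:
  assumes "T \<subseteq> X" "finite T" "Suc (card T) = k" "y \<in> X" "y \<notin> T"
  shows "y + \<Sum>T \<in> FS k X"
proof -
  have "y + \<Sum>T = \<Sum>(insert y T)" "card (insert y T) = k"
    using assms by auto
  then show ?thesis
    unfolding FS_def using assms by blast
qed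

text \<open>A functional graph is 2-degenerate: either some vertex has in-degree 0, or \<open>f\<close> permutes \<open>B\<close>.\<close>

lemma three_colouring:
  assumes "finite B"
  shows "\<exists>c :: 'b \<Rightarrow> nat. (\<forall>x. c x < 3) \<and> (\<forall>x\<in>B. f x \<in> B \<longrightarrow> f x \<noteq> x \<longrightarrow> c (f x) \<noteq> c x)"
  using assms
proof (induction B rule: finite_psubset_induct)
  case (psubset B)
  show ?case
  proof (cases "B = {}")
    case True
    then show ?thesis by (intro exI[of _ "\<lambda>_. 0"]) auto
  next
    case False
    obtain b d where b: "b \<in> B" and d: "\<And>x. x \<in> B \<Longrightarrow> f x = b \<Longrightarrow> x = d"
    proof (cases "B \<subseteq> f ` B")
      case True
      then have "inj_on f B"
        using psubset.hyps(1) by (meson card_image_le card_mono eq_card_imp_inj_on finite_imageI le_antisym)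
      moreover obtain d where "d \<in> B" "f d \<in> B"
        using True False by blast
      ultimately show ?thesis
        using that[of "f d" d] by (auto dest: inj_onD)
    next
      case False
      then show ?thesis using that by blast
    qed
    obtain c :: "'b \<Rightarrow> nat" where c: "\<And>x. c x < 3"
      "\<And>x. x \<in> B - {b} \<Longrightarrow> f x \<in> B - {b} \<Longrightarrow> f x \<noteq> x \<Longrightarrow> c (f x) \<noteq> c x"
      using psubset.IH[of "B - {b}"] b by blast
    obtain e :: nat where e: "e < 3" "e \<noteq> c (f b)" "e \<noteq> c d"
    proof -
      have "card {c (f b), c d} < card {..<3::nat}"
        by (simp add: card_insert_if)
      then have "\<not> {..<3} \<subseteq> {c (f b), c d}"
        by (meson card_mono finite.emptyI finite_insert not_le)
      then show ?thesis using that by blast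
    qed
    have "(c(b := e)) (f x) \<noteq> (c(b := e)) x" if "x \<in> B" "f x \<in> B" "f x \<noteq> x" for x
      using that c(2)[of x] d[of x] e by auto
    moreover have "\<forall>x. (c(b := e)) x < 3"
      using c(1) e(1) by simp
    ultimately show ?thesis by blast
  qed
qed

subsection \<open>Lattices\<close>

lemma Ints_of_nat_mult_dvd:
  assumes "a dvd b" "of_nat a * (q :: rat) \<in> \<int>"
  shows "of_nat b * q \<in> \<int>"
proof -
  obtain m where "b = m * a" using assms(1) by (metis dvdE mult.commute)
  then have "of_nat b * q = of_nat m * (of_nat a * q)" by simp
  then show ?thesis using assms(2) by (simp only: Ints_mult Ints_of_nat)
qed

lemma frac_eq_frac_iff: "frac x = frac y \<longleftrightarrow> x - y \<in> \<int>"
proof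
  assume "frac x = frac y"
  then have "x - y = of_int (\<lfloor>x\<rfloor> - \<lfloor>y\<rfloor>)" by (simp add: frac_def)
  then show "x - y \<in> \<int>" by (simp only: Ints_of_int)
next
  assume "x - y \<in> \<int>"
  then have "frac ((x - y) + y) = frac y" by (rule frac_add_int_left)
  then show "frac x = frac y" by simp
qed

text \<open>The power lets division by \<open>k\<close> or \<open>k - 1\<close> cost only one level;
  the factorial ensures that every denominator eventually divides some
  \<open>latden k i\<close>.\<close>

definition latden :: "nat \<Rightarrow> nat \<Rightarrow> nat" where
  "latden k i = (k * (k - 1)) ^ i * fact i"

definition lattice :: "nat \<Rightarrow> nat \<Rightarrow> ('a \<Rightarrow>\<^sub>0 rat) set" where
  "lattice k i = {x. \<forall>j. of_nat (latden k i) * coord x j \<in> \<int>}"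

lemma latden_pos: "k \<ge> 2 \<Longrightarrow> latden k i > 0"
  by (simp add: latden_def)

lemma latden_Suc: "latden k (Suc i) = Suc i * (k * (k - 1) * latden k i)"
  by (simp add: latden_def algebra_simps)

lemma latden_dvd: "i \<le> i' \<Longrightarrow> latden k i dvd latden k i'"
  by (simp add: latden_def mult_dvd_mono le_imp_power_dvd fact_dvd)

lemma lattice_mono: "i \<le> i' \<Longrightarrow> lattice k i \<subseteq> lattice k i'"
  unfolding lattice_def using Ints_of_nat_mult_dvd latden_dvd by blast

lemma lattice_exhausts:
  fixes x :: "'a \<Rightarrow>\<^sub>0 rat"
  assumes "k \<ge> 2"
  shows "\<exists>i. x \<in> lattice k i"
proof -
  have "\<exists>d. d > 0 \<and> of_nat d * q \<in> \<int>" for q :: rat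
  proof (cases q)
    case (Fract a b)
    then have "of_nat (nat b) * q = of_int a"
      by (simp add: Fract_of_int_quotient of_nat_nat)
    then show ?thesis
      using Fract by (intro exI[of _ "nat b"]) auto
  qed
  then obtain d :: "rat \<Rightarrow> nat" where d: "d q > 0" "of_nat (d q) * q \<in> \<int>" for q
    by metis
  \<comment> \<open>A common denominator of all coordinates; it divides its own factorial, so it can
    serve as the index too.\<close>
  define i where "i = (\<Prod>j\<in>Poly_Mapping.keys x. d (coord x j))"
  have "i > 0" unfolding i_def using d(1) by (simp add: prod_pos)
  then have "i dvd latden k i"
    by (simp add: latden_def dvd_fact)
  have "of_nat (latden k i) * coord x j \<in> \<int>" for j
  proof (cases "j \<in> Poly_Mapping.keys x")
    case True
    then have "d (coord x j) dvd i"
      unfolding i_def by (intro dvd_prodI) auto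
    then show ?thesis
      using \<open>i dvd latden k i\<close> d(2) Ints_of_nat_mult_dvd dvd_trans by blast
  qed (simp add: in_keys_iff)
  then show ?thesis unfolding lattice_def by blast
qed

text \<open>Holds because \<open>m * latden k i\<close> divides \<open>latden k (Suc i)\<close>.
  Taking \<open>m = k\<close> bounds the drop in level under multiplication by \<open>k\<close>;
  taking \<open>m = k - 1\<close> shows that \<open>k y\<close> and \<open>y\<close> differ modulo
  the lattice.\<close>

lemma lattice_div:
  assumes "x \<notin> lattice k (Suc i)" "m dvd k * (k - 1)"
  shows "\<exists>j. of_nat m * (of_nat (latden k i) * coord x j) \<notin> \<int>"
proof -
  obtain j where j: "of_nat (latden k (Suc i)) * coord x j \<notin> \<int>"
    using assms(1) unfolding lattice_def by blast
  have "m * latden k i dvd latden k (Suc i)"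
    unfolding latden_Suc by (intro dvd_mult mult_dvd_mono assms(2) dvd_refl)
  then have "of_nat (m * latden k i) * coord x j \<notin> \<int>"
    using j Ints_of_nat_mult_dvd by blast
  then show ?thesis by (auto simp: mult.assoc)
qed

section \<open>Levels and residues modulo a lattice\<close>

definition level :: "nat \<Rightarrow> ('a \<Rightarrow>\<^sub>0 rat) \<Rightarrow> nat" where
  "level k x = (LEAST i. x \<in> lattice k i)"

lemma level_le_iff:
  assumes "k \<ge> 2"
  shows "level k x \<le> i \<longleftrightarrow> x \<in> lattice k i"
proof
  have "x \<in> lattice k (level k x)"
    unfolding level_def using lattice_exhausts[OF assms, of x] by (rule LeastI_ex)
  then show "level k x \<le> i \<Longrightarrow> x \<in> lattice k i"
    using lattice_mono by blast
qed (simp add: level_def Least_le)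

text \<open>Encodes the coset modulo \<open>lattice k i\<close>: after scaling, the lattice consists
  of the integral vectors, and fractional parts label the cosets.\<close>

definition residue :: "nat \<Rightarrow> nat \<Rightarrow> ('a \<Rightarrow>\<^sub>0 rat) \<Rightarrow> 'a \<Rightarrow> rat" where
  "residue k i x = (\<lambda>j. frac (of_nat (latden k i) * coord x j))"

lemma residue_add:
  assumes "s \<in> lattice k i"
  shows "residue k i (y + s) = residue k i y"
  using assms by (auto simp: residue_def lattice_def lookup_add distrib_left frac_eq_frac_iff)

text \<open>The right-hand side depends on the residue only, so multiplication by \<open>k\<close>
  acts as a map on residues, to which \<open>three_colouring\<close> applies.\<close>

lemma residue_multiple:
  "residue k i (multiple m y) = (\<lambda>j. frac (of_nat m * residue k i y j))"
proof
  fix j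
  let ?t = "of_nat (latden k i) * coord y j"
  have "of_nat m * ?t - of_nat m * frac ?t = of_nat m * of_int \<lfloor>?t\<rfloor>"
    by (simp add: frac_def algebra_simps)
  then have "of_nat m * ?t - of_nat m * frac ?t \<in> \<int>" by simp
  then show "residue k i (multiple m y) j = frac (of_nat m * residue k i y j)"
    by (simp add: residue_def lookup_multiple frac_eq_frac_iff mult.left_commute)
qed

section \<open>Finiteness of residues and of lattice balls\<close>

lemma finite_bounded_denominator:
  assumes "N > 0"
  shows "finite {q :: rat. of_nat N * q \<in> \<int> \<and> \<bar>q\<bar> \<le> C}"
proof (rule finite_subset)
  let ?m = "\<lceil>of_nat N * C\<rceil>"
  show "{q :: rat. of_nat N * q \<in> \<int> \<and> \<bar>q\<bar> \<le> C} \<subseteq> (\<lambda>a. of_int a / of_nat N) ` {-?m..?m}"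
  proof safe
    fix q :: rat assume "of_nat N * q \<in> \<int>" and q: "\<bar>q\<bar> \<le> C"
    then obtain a where a: "of_nat N * q = of_int a" by (auto elim: Ints_cases)
    have "\<bar>of_int a :: rat\<bar> \<le> of_nat N * C"
      unfolding a[symmetric] abs_mult using q by (simp add: mult_left_mono)
    also have "\<dots> \<le> of_int ?m" by (rule le_of_int_ceiling)
    finally have "\<bar>a\<bar> \<le> ?m" by linarith
    moreover have "q = of_int a / of_nat N"
      using a assms by (simp add: field_simps)
    ultimately show "q \<in> (\<lambda>a. of_int a / of_nat N) ` {-?m..?m}"
      by (intro image_eqI[of _ _ a]) auto
  qed
qed simp

text \<open>Each entry has absolute value at most 1 and is made integral by
  \<open>latden k i'\<close>, and entries outside the finite set \<open>J\<close> vanish.\<close>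

lemma finite_lattice_residues:
  assumes "finite J" "k \<ge> 2"
  shows "finite (residue k i ` (rat_direct_sum J \<inter> lattice k i'))"
proof -
  let ?Q = "{q :: rat. of_nat (latden k i') * q \<in> \<int> \<and> \<bar>q\<bar> \<le> 1}"
  have "residue k i x j \<in> ?Q" if "x \<in> lattice k i'" for x :: "'a \<Rightarrow>\<^sub>0 rat" and j
  proof -
    let ?t = "of_nat (latden k i) * coord x j" and ?N = "of_nat (latden k i') :: rat"
    have "?N * coord x j \<in> \<int>" using that unfolding lattice_def by blast
    then have "of_nat (latden k i) * (?N * coord x j) - ?N * of_int \<lfloor>?t\<rfloor> \<in> \<int>"
      by (rule Ints_diff[OF Ints_mult[OF Ints_of_nat] Ints_mult[OF Ints_of_nat Ints_of_int]])
    also have "of_nat (latden k i) * (?N * coord x j) - ?N * of_int \<lfloor>?t\<rfloor> = ?N * frac ?t"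
      by (simp add: frac_def algebra_simps)
    finally have "?N * frac ?t \<in> \<int>" .
    moreover have "\<bar>frac ?t\<bar> \<le> 1"
      using frac_lt_1[of ?t] by simp
    ultimately show ?thesis by (simp add: residue_def)
  qed
  moreover have "residue k i x j = 0" if "x \<in> rat_direct_sum J" "j \<notin> J" for x :: "'a \<Rightarrow>\<^sub>0 rat" and j
    using that by (simp add: residue_def rat_direct_sum_iff)
  ultimately have "residue k i ` (rat_direct_sum J \<inter> lattice k i')
      \<subseteq> {g. \<forall>j. (j \<in> J \<longrightarrow> g j \<in> ?Q) \<and> (j \<notin> J \<longrightarrow> g j = 0)}"
    by blast
  then show ?thesis
    using finite_set_of_finite_funs[OF assms(1) finite_bounded_denominator[OF latden_pos[OF assms(2)]]]
    by (rule finite_subset)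
qed

definition l1norm :: "'a set \<Rightarrow> ('a \<Rightarrow>\<^sub>0 rat) \<Rightarrow> rat" where
  "l1norm J x = (\<Sum>j\<in>J. \<bar>coord x j\<bar>)"

lemma l1norm_multiple: "l1norm J (multiple k x) = of_nat k * l1norm J x"
  by (simp add: l1norm_def lookup_multiple abs_mult sum_distrib_left)

lemma l1norm_add: "l1norm J (x + y) \<le> l1norm J x + l1norm J y"
  by (simp add: l1norm_def lookup_add sum.distrib[symmetric] sum_mono abs_triangle_ineq)

lemma l1norm_add_ge: "l1norm J x - l1norm J y \<le> l1norm J (x + y)"
  by (simp add: l1norm_def lookup_add sum_subtractf[symmetric] sum_mono)

text \<open>Hence an infinite set inside one lattice has unbounded norm.\<close>

lemma finite_lattice_ball:
  assumes "finite J" "k \<ge> 2"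
  shows "finite {x \<in> rat_direct_sum J \<inter> lattice k i. l1norm J x \<le> C}" (is "finite ?S")
proof -
  let ?Q = "{q :: rat. of_nat (latden k i) * q \<in> \<int> \<and> \<bar>q\<bar> \<le> C}"
  have "\<bar>coord x j\<bar> \<le> C" if "x \<in> ?S" "j \<in> J" for x j
    using that member_le_sum[of j J "\<lambda>j. \<bar>coord x j\<bar>"] assms(1)
    by (fastforce simp: l1norm_def)
  then have "coord ` ?S \<subseteq> {g. \<forall>j. (j \<in> J \<longrightarrow> g j \<in> ?Q) \<and> (j \<notin> J \<longrightarrow> g j = 0)}"
    by (auto simp: rat_direct_sum_iff lattice_def)
  then have "finite (coord ` ?S)"
    using finite_set_of_finite_funs[OF assms(1) finite_bounded_denominator[OF latden_pos[OF assms(2)]]]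
    by (rule finite_subset)
  then show ?thesis
    by (rule finite_imageD) (simp add: inj_on_def)
qed

subsection \<open>Finitely many coordinates\<close>

text \<open>Multiplication by \<kappa> shifts twice the logarithm by exactly 2. The squares of
  \<open>b / a\<close> and \<open>a / b\<close> are at most 2, hence at most \<kappa>, so passing
  from \<open>a\<close> to \<open>b\<close> shifts it by at most 1. The two floors thus differ by 1,
  2 or 3, which is nonzero modulo 4.\<close>

lemma two_log_close:
  fixes a b \<kappa> :: real
  assumes "\<kappa> \<ge> 2" "a > 0" "b > 0" "b \<le> 5/4 * a" "3/4 * a \<le> b"
  shows "\<lfloor>2 * log \<kappa> (\<kappa> * a)\<rfloor> mod 4 \<noteq> \<lfloor>2 * log \<kappa> b\<rfloor> mod 4"
proof -
  have "b * b \<le> (5/4 * a) * (5/4 * a)"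
    using assms by (intro mult_mono) auto
  also have "\<dots> \<le> 2 * (a * a)" using assms by simp
  also have "\<dots> \<le> \<kappa> * (a * a)" using assms by (intro mult_right_mono) auto
  finally have "log \<kappa> (b * b) \<le> log \<kappa> (\<kappa> * (a * a))"
    using assms by simp
  then have 1: "2 * log \<kappa> b \<le> 1 + 2 * log \<kappa> a"
    using assms by (simp add: log_mult)
  have "a * a \<le> (4/3 * b) * (4/3 * b)"
    using assms by (intro mult_mono) auto
  also have "\<dots> \<le> 2 * (b * b)" using assms by simp
  also have "\<dots> \<le> \<kappa> * (b * b)" using assms by (intro mult_right_mono) auto
  finally have "log \<kappa> (a * a) \<le> log \<kappa> (\<kappa> * (b * b))"
    using assms by simp
  then have 2: "2 * log \<kappa> a \<le> 1 + 2 * log \<kappa> b"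
    using assms by (simp add: log_mult)
  have "2 * log \<kappa> (\<kappa> * a) = 2 * log \<kappa> a + 2"
    using assms by (simp add: log_mult)
  then have "\<lfloor>2 * log \<kappa> (\<kappa> * a)\<rfloor> = \<lfloor>2 * log \<kappa> a\<rfloor> + 2" by linarith
  moreover have "\<lfloor>2 * log \<kappa> b\<rfloor> \<in> {\<lfloor>2 * log \<kappa> a\<rfloor> - 1, \<lfloor>2 * log \<kappa> a\<rfloor>, \<lfloor>2 * log \<kappa> a\<rfloor> + 1}"
    using 1 2 by simp linarith
  ultimately show ?thesis by auto presburger+
qed

lemma good_finite:
  fixes J :: "'a set"
  assumes J: "finite J" and k: "k \<ge> 2"
  shows "good k J 24"
proof -
  have "\<exists>c :: ('a \<Rightarrow> rat) \<Rightarrow> nat. (\<forall>g. c g < 3) \<and>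
      (\<forall>g\<in>residue k i ` (rat_direct_sum J \<inter> lattice k (i + 2)).
        (\<lambda>j. frac (of_nat k * g j)) \<in> residue k i ` (rat_direct_sum J \<inter> lattice k (i + 2)) \<longrightarrow>
        (\<lambda>j. frac (of_nat k * g j)) \<noteq> g \<longrightarrow> c (\<lambda>j. frac (of_nat k * g j)) \<noteq> c g)" for i
    by (rule three_colouring[OF finite_lattice_residues[OF J k]])
  then obtain col :: "nat \<Rightarrow> ('a \<Rightarrow> rat) \<Rightarrow> nat" where col3: "\<And>i g. col i g < 3"
    and col: "\<And>i g. g \<in> residue k i ` (rat_direct_sum J \<inter> lattice k (i + 2)) \<Longrightarrow>
        (\<lambda>j. frac (of_nat k * g j)) \<in> residue k i ` (rat_direct_sum J \<inter> lattice k (i + 2)) \<Longrightarrow>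
        (\<lambda>j. frac (of_nat k * g j)) \<noteq> g \<Longrightarrow> col i (\<lambda>j. frac (of_nat k * g j)) \<noteq> col i g"
    by metis
  define c1 where "c1 x = level k x mod 2" for x :: "'a \<Rightarrow>\<^sub>0 rat"
  \<comment> \<open>The residue is read two levels below that of \<open>x\<close>. The subtraction
    truncates, but \<open>c2\<close> is only evaluated in the argument at levels of the form
    \<open>i + 2\<close>.\<close>
  define c2 where "c2 x = col (level k x - 2) (residue k (level k x - 2) x)" for x
  define c3 where "c3 x = nat (\<lfloor>2 * log (real k) (real_of_rat (l1norm J x))\<rfloor> mod 4)" for x
  \<comment> \<open>Mixed-radix code of the triple, giving 2 * 3 * 4 = 24 colours.\<close>
  define c where "c x = c1 x + 2 * (c2 x + 3 * c3 x)" for x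
  have bounds: "c1 x < 2" "c2 x < 3" "c3 x < 4" for x
    by (auto simp: c1_def c2_def c3_def col3 nat_less_iff)
  have split_c: "c1 x = c1 y \<and> c2 x = c2 y \<and> c3 x = c3 y" if "c x = c y" for x y
  proof -
    have "c1 z = c z mod 2" "c z div 2 = c2 z + 3 * c3 z" for z
      using bounds(1)[of z] by (simp_all add: c_def del: distrib_left_numeral)
    moreover have "c2 z = (c2 z + 3 * c3 z) mod 3" "c3 z = (c2 z + 3 * c3 z) div 3" for z
      using bounds(2)[of z] by simp_all
    ultimately show ?thesis using that by metis
  qed
  have "\<not> monochromatic c (FS k X \<union> multiple k ` X)"
    if X: "X \<subseteq> rat_direct_sum J" "infinite X" for X
  proof
    assume mono: "monochromatic c (FS k X \<union> multiple k ` X)"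
    obtain T where T: "T \<subseteq> X" "finite T" "card T = k - 1"
      using infinite_arbitrarily_large[OF X(2)] by blast
    define s where "s = \<Sum>T"
    have eq: "c (y + s) = c (multiple k y)" if "y \<in> X" "y \<notin> T" for y
      using add_sum_in_FS[OF T(1,2) _ that, of k] T(3) k that(1) mono
      unfolding monochromatic_def s_def by fastforce
    show False
    \<comment> \<open>Either some \<open>y\<close> lies at least two levels above \<open>s\<close>,
      or all of \<open>X - T\<close> lies in one lattice and the norm takes over.\<close>
    proof (cases "\<exists>y \<in> X - T. level k y \<ge> level k s + 2")
      case True
      then obtain y where y: "y \<in> X" "y \<notin> T" "level k y \<ge> level k s + 2" by blast
      define i where "i = level k y - 2"
      have ly: "level k y = i + 2" and ls: "s \<in> lattice k i"
        using y(3) level_le_iff[OF k, of s i] by (auto simp: i_def)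
      have ny: "y \<notin> lattice k (Suc i)" and y2: "y \<in> lattice k (i + 2)"
        using level_le_iff[OF k, of y] ly by (metis Suc_n_not_le_n add_2_eq_Suc', metis order_refl)
      have lys: "level k (y + s) = i + 2"
      proof -
        have ls': "s \<in> lattice k (Suc i)" "s \<in> lattice k (i + 2)"
          using ls lattice_mono[of i "Suc i" k] lattice_mono[of i "i + 2" k] by auto
        have "y + s \<in> lattice k (i + 2)"
          using y2 ls'(2) by (auto simp: lattice_def lookup_add distrib_left)
        moreover have "y + s \<notin> lattice k (Suc i)"
        proof
          assume *: "y + s \<in> lattice k (Suc i)"
          have "of_nat (latden k (Suc i)) * coord y j \<in> \<int>" for j
          proof -
            have "of_nat (latden k (Suc i)) * coord (y + s) j - of_nat (latden k (Suc i)) * coord s j \<in> \<int>"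
              using * ls'(1) unfolding lattice_def by (intro Ints_diff) blast+
            then show ?thesis by (simp add: lookup_add algebra_simps)
          qed
          then show False using ny unfolding lattice_def by blast
        qed
        ultimately show ?thesis
          unfolding level_le_iff[OF k, symmetric] by simp
      qed
      have "multiple k y \<in> lattice k (i + 2)"
        using y2 by (auto simp: lattice_def lookup_multiple mult.left_commute)
      moreover have "multiple k y \<notin> lattice k i"
        using lattice_div[OF ny, of k] by (auto simp: lattice_def lookup_multiple mult.left_commute)
      ultimately have "level k (multiple k y) \<in> {i + 1, i + 2}"
        unfolding level_le_iff[OF k, symmetric] by auto
      \<comment> \<open>Parity excludes level \<open>i + 1\<close>, so multiplication by
        \<open>k\<close> keeps the level.\<close>
      moreover have "level k (multiple k y) mod 2 = (i + 2) mod 2"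
        using split_c[OF eq[OF y(1,2)]] lys by (simp add: c1_def)
      ultimately have lky: "level k (multiple k y) = i + 2"
        by auto presburger
      let ?g = "residue k i y"
      \<comment> \<open>The graph has no loop at this residue: a loop would put
        \<open>(k - 1) y\<close> into \<open>lattice k i\<close>. So the 3-colouring distinguishes
        its two ends.\<close>
      have "(\<lambda>j. frac (of_nat k * ?g j)) \<noteq> ?g"
      proof
        assume "(\<lambda>j. frac (of_nat k * ?g j)) = ?g"
        then have "residue k i (multiple k y) j = ?g j" for j
          by (metis residue_multiple)
        then have "of_nat (latden k i) * (of_nat k * coord y j) - of_nat (latden k i) * coord y j \<in> \<int>" for j
          by (simp add: residue_def lookup_multiple frac_eq_frac_iff)
        then have "of_nat (k - 1) * (of_nat (latden k i) * coord y j) \<in> \<int>" for j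
          using k by (simp add: of_nat_diff algebra_simps)
        then show False
          using lattice_div[OF ny, of "k - 1"] by auto
      qed
      moreover have "?g \<in> residue k i ` (rat_direct_sum J \<inter> lattice k (i + 2))"
        using y2 y(1) X(1) by blast
      moreover have "(\<lambda>j. frac (of_nat k * ?g j)) \<in> residue k i ` (rat_direct_sum J \<inter> lattice k (i + 2))"
        unfolding residue_multiple[symmetric]
        using \<open>multiple k y \<in> lattice k (i + 2)\<close> y(1) X(1) multiple_in_rat_direct_sum by blast
      ultimately have "col i (\<lambda>j. frac (of_nat k * ?g j)) \<noteq> col i ?g"
        using col by blast
      moreover have "col i (\<lambda>j. frac (of_nat k * ?g j)) = col i ?g"
        using split_c[OF eq[OF y(1,2)]] lys lky
        by (simp add: c2_def residue_add[OF ls] residue_multiple)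
      ultimately show False by simp
    next
      case False
      \<comment> \<open>Beyond this bound \<open>s\<close> has less than a quarter of the norm of
        \<open>y\<close>, which yields the ratios 3/4 and 5/4 of
        \<open>two_log_close\<close>.\<close>
      let ?C = "4 * l1norm J s"
      have "X - T \<subseteq> rat_direct_sum J \<inter> lattice k (level k s + 2)"
        using False X(1) level_le_iff[OF k] by (meson DiffD1 IntI nle_le subsetD subsetI)
      moreover have "infinite (X - T)"
        using X(2) T(2) by simp
      moreover have "finite {x \<in> rat_direct_sum J \<inter> lattice k (level k s + 2). l1norm J x \<le> ?C}"
        by (rule finite_lattice_ball[OF J k])
      ultimately obtain y where y: "y \<in> X" "y \<notin> T" "l1norm J y > ?C"
        by (smt (verit, best) DiffD1 DiffD2 finite_subset mem_Collect_eq not_le subset_iff)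
      define a b where "a = l1norm J y" and "b = l1norm J (y + s)"
      have "l1norm J s \<ge> 0" by (simp add: l1norm_def sum_nonneg)
      then have ab: "a > 0" "b > 0" "b \<le> 5/4 * a" "3/4 * a \<le> b"
        using y(3) l1norm_add[of J y s] l1norm_add_ge[of J y s] unfolding a_def b_def by linarith+
      have "\<lfloor>2 * log (real k) (real k * real_of_rat a)\<rfloor> mod 4 \<noteq> \<lfloor>2 * log (real k) (real_of_rat b)\<rfloor> mod 4"
      proof (rule two_log_close)
        show "real_of_rat b \<le> 5/4 * real_of_rat a"
          using ab(3) of_rat_less_eq[of b "5/4 * a", where 'a = real]
          by (simp add: of_rat_mult of_rat_divide)
        show "3/4 * real_of_rat a \<le> real_of_rat b"
          using ab(4) of_rat_less_eq[of "3/4 * a" b, where 'a = real]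
          by (simp add: of_rat_mult of_rat_divide)
      qed (use k ab in auto)
      moreover have "c3 (y + s) = c3 (multiple k y)"
        using split_c[OF eq[OF y(1,2)]] by simp
      ultimately show False
        by (simp add: c3_def l1norm_multiple a_def b_def of_rat_mult nat_eq_iff)
    qed
  qed
  moreover have "c x < 24" for x
    using bounds[of x] unfolding c_def by presburger
  ultimately show ?thesis
    unfolding good_def by blast
qed

subsection \<open>Passing to the next cardinal\<close>

lemma finite_has_max:
  assumes "finite F" "F \<noteq> {}" "F \<subseteq> J" "linear_order_on J r"
  shows "\<exists>m\<in>F. \<forall>j\<in>F. (j, m) \<in> r"
  using assms(1-3)
proof (induction F rule: finite_ne_induct)
  case (singleton x)
  then show ?case
    using assms(4) by (auto simp: order_on_defs refl_on_def)
next
  case (insert x F)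
  then obtain m where m: "m \<in> F" "\<forall>j\<in>F. (j, m) \<in> r" by auto
  have "x \<in> J" "m \<in> J" using insert m(1) by auto
  have r: "refl_on J r" "trans r" "total_on J r"
    using assms(4) by (auto simp: order_on_defs)
  consider "(x, m) \<in> r" | "(m, x) \<in> r"
    using r \<open>x \<in> J\<close> \<open>m \<in> J\<close> unfolding total_on_def by (metis refl_onD)
  then show ?case
  proof cases
    case 1
    then show ?thesis using m by auto
  next
    case 2
    then have "\<forall>j\<in>insert x F. (j, x) \<in> r"
      using m(2) r \<open>x \<in> J\<close> by (metis insertE refl_onD transD)
    then show ?thesis by blast
  qed
qed

text \<open>Supports are finite, so each nonzero vector has a largest coordinate and is coloured by
  the colouring of the segment up to it. One extra bit handles sets whose largest coordinates take
  infinitely many values.\<close>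

lemma good_step:
  fixes J :: "'a set"
  assumes r: "linear_order_on J r" and k: "k \<ge> 2" and N: "N > 0"
    and seg: "\<And>i. i \<in> J \<Longrightarrow> good k {j. (j, i) \<in> r} N"
  shows "good k J (2 * N)"
proof -
  have ord: "refl_on J r" "trans r" "antisym r"
    using r by (auto simp: order_on_defs)
  obtain d where d: "\<And>i. i \<in> J \<Longrightarrow> d i \<in> rat_direct_sum {j. (j, i) \<in> r} \<rightarrow> {..<N}"
    and dX: "\<And>i X. i \<in> J \<Longrightarrow> X \<subseteq> rat_direct_sum {j. (j, i) \<in> r} \<Longrightarrow> infinite X \<Longrightarrow>
      \<not> monochromatic (d i) (FS k X \<union> multiple k ` X)"
    using seg unfolding good_def by metis
  define top where "top x i \<longleftrightarrow> coord x i \<noteq> 0 \<and> (\<forall>j. coord x j \<noteq> 0 \<longrightarrow> (j, i) \<in> r)"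
    for x :: "'a \<Rightarrow>\<^sub>0 rat" and i
  have top_in: "i \<in> J" if "x \<in> rat_direct_sum J" "top x i" for x i
    using that by (auto simp: top_def rat_direct_sum_iff)
  have top_seg: "x \<in> rat_direct_sum {j. (j, i) \<in> r}" if "top x i" for x i
    using that by (auto simp: top_def rat_direct_sum_iff)
  have top_ex: "\<exists>i. top x i" if "x \<in> rat_direct_sum J" "x \<noteq> 0" for x
    using finite_has_max[OF finite_keys[of x] _ _ r] that
    by (auto simp: top_def rat_direct_sum_def in_keys_iff)
  have top_unique: "i = i'" if "top x i" "top x i'" for x i i'
    using that ord(3) by (auto simp: top_def dest: antisymD)
  define \<sigma> where "\<sigma> x = (THE i. top x i)" for x
  have \<sigma>_eq: "\<sigma> x = i" if "top x i" for x i
    unfolding \<sigma>_def using that top_unique by blast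
  define bit where "bit x = nat (\<lfloor>log (real k) \<bar>real_of_rat (coord x (\<sigma> x))\<bar>\<rfloor> mod 2)" for x
  \<comment> \<open>The zero vector has no top coordinate and gets a default colour; it is removed
    from \<open>X\<close> below.\<close>
  define c where "c x = (if x = 0 then 0 else 2 * d (\<sigma> x) x + bit x)" for x
  have bit: "bit x < 2" for x
    by (auto simp: bit_def nat_less_iff)
  have split_c: "d (\<sigma> x) x = d (\<sigma> y) y \<and> bit x = bit y" if "c x = c y" "x \<noteq> 0" "y \<noteq> 0" for x y
    using that bit[of x] bit[of y] unfolding c_def by simp presburger
  have top_multiple: "top (multiple k x) i" if "top x i" for x i
    using that k by (simp add: top_def lookup_multiple)
  have top_nz: "x \<noteq> 0" if "top x i" for x i
    using that by (auto simp: top_def)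
  have "\<not> monochromatic c (FS k X \<union> multiple k ` X)"
    if X: "X \<subseteq> rat_direct_sum J" "infinite X" for X
  proof
    assume "monochromatic c (FS k X \<union> multiple k ` X)"
    define Y where "Y = X - {0}"
    have Y: "Y \<subseteq> rat_direct_sum J" "infinite Y"
      using X by (auto simp: Y_def)
    have mono: "monochromatic c (FS k Y \<union> multiple k ` Y)"
      using \<open>monochromatic c (FS k X \<union> multiple k ` X)\<close> FS_mono[of Y X k]
      by (rule_tac monochromatic_subset) (auto simp: Y_def)
    have top: "top x (\<sigma> x)" if "x \<in> Y" for x
      using that Y(1) top_ex[of x] \<sigma>_eq by (auto simp: Y_def)
    show False
    proof (cases "finite (\<sigma> ` Y)")
      case True
      then obtain x0 where "x0 \<in> Y" and inf: "infinite {x \<in> Y. \<sigma> x = \<sigma> x0}"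
        using pigeonhole_infinite[OF Y(2)] by blast
      define i where "i = \<sigma> x0"
      have iJ: "i \<in> J"
        using top_in top \<open>x0 \<in> Y\<close> Y(1) unfolding i_def by blast
      let ?s = "\<lambda>x. coord x i > 0"
      \<comment> \<open>A constant sign at \<open>i\<close> prevents cancellation there, so sums
        from \<open>Z\<close> keep \<open>i\<close> as top coordinate.\<close>
      obtain Z b where Z: "infinite Z" "Z \<subseteq> Y" "\<And>x. x \<in> Z \<Longrightarrow> \<sigma> x = i" "\<And>x. x \<in> Z \<Longrightarrow> ?s x = b"
      proof -
        obtain x1 where "infinite {x \<in> {x \<in> Y. \<sigma> x = \<sigma> x0}. ?s x = ?s x1}"
          using pigeonhole_infinite[OF inf, of ?s] by auto
        then show ?thesis
          by (rule that[of _ "?s x1"]) (auto simp: i_def)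
      qed
      have topZ: "top x i" if "x \<in> Z" for x
        using top[of x] Z(3)[OF that] Z(2) that by auto
      have topF: "top (\<Sum>F) i" if F: "F \<subseteq> Z" "card F = k" for F
      proof -
        have "finite F" "F \<noteq> {}" using F(2) k by (auto intro: card_ge_0_finite)
        have nz: "coord x i \<noteq> 0" if "x \<in> F" for x
          using that F(1) topZ by (auto simp: top_def)
        have "coord (\<Sum>F) i \<noteq> 0"
        proof (cases b)
          case True
          then have "(\<Sum>x\<in>F. coord x i) > 0"
            using Z(4) F(1) \<open>finite F\<close> \<open>F \<noteq> {}\<close> by (intro sum_pos) auto
          then show ?thesis by (simp add: lookup_sum)
        next
          case False
          then have "\<And>x. x \<in> F \<Longrightarrow> coord x i < 0"
            using Z(4) F(1) nz by (metis linorder_neqE_linordered_idom subsetD)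
          then have "(\<Sum>x\<in>F. - coord x i) > 0"
            using \<open>finite F\<close> \<open>F \<noteq> {}\<close> by (intro sum_pos) auto
          then show ?thesis by (simp add: lookup_sum sum_negf)
        qed
        moreover have "(j, i) \<in> r" if "coord (\<Sum>F) j \<noteq> 0" for j
        proof -
          have "\<exists>x\<in>F. coord x j \<noteq> 0"
            using that unfolding lookup_sum by (meson sum.neutral)
          then show ?thesis
            using F(1) topZ by (auto simp: top_def)
        qed
        ultimately show ?thesis by (simp add: top_def)
      qed
      have topS: "top z i" if "z \<in> FS k Z \<union> multiple k ` Z" for z
        using that topF topZ top_multiple by (auto simp: FS_def)
      have "FS k Z \<union> multiple k ` Z \<subseteq> FS k Y \<union> multiple k ` Y"
        using Z(2) FS_mono[of Z Y k] by blast
      then obtain v where v: "\<forall>z \<in> FS k Z \<union> multiple k ` Z. c z = v"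
        using mono unfolding monochromatic_def by blast
      \<comment> \<open>Halving strips the bit, leaving the colour assigned by the segment of
        \<open>i\<close>.\<close>
      have "d i z = v div 2" if "z \<in> FS k Z \<union> multiple k ` Z" for z
        using that v topS[OF that] \<sigma>_eq top_nz bit[of z] unfolding c_def by fastforce
      then have "monochromatic (d i) (FS k Z \<union> multiple k ` Z)"
        unfolding monochromatic_def by blast
      moreover have "Z \<subseteq> rat_direct_sum {j. (j, i) \<in> r}"
        using topZ top_seg by blast
      ultimately show False
        using dX[OF iJ _ Z(1)] by blast
    next
      case False
      then obtain A where A: "A \<subseteq> \<sigma> ` Y" "finite A" "card A = k"
        using infinite_arbitrarily_large by blast
      \<comment> \<open>\<open>W\<close> consists of \<open>k\<close> vectors with distinct top
        coordinates; the one with the largest will dominate their sum.\<close>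
      then obtain W where W: "W \<subseteq> Y" "inj_on \<sigma> W" "A = \<sigma> ` W"
        by (meson subset_image_inj)
      have fW: "finite W" and cW: "card W = k"
        using A W by (auto simp: finite_image_iff card_image)
      have "A \<subseteq> J"
        using A(1) top top_in Y(1) by blast
      then obtain m where m: "m \<in> A" "\<forall>j\<in>A. (j, m) \<in> r"
        using finite_has_max[OF A(2) _ _ r] A(3) k by fastforce
      then obtain y where y: "y \<in> W" "\<sigma> y = m" using W(3) by blast
      define T where "T = W - {y}"
      \<comment> \<open>The other summands vanish from \<open>m\<close> upwards, so the sum has the
        same leading coefficient as \<open>y\<close>.\<close>
      have small: "coord x j = 0" if "x \<in> T" "(m, j) \<in> r" for x j
      proof (rule ccontr)
        assume "coord x j \<noteq> 0"
        moreover have x: "x \<in> W" "x \<noteq> y" using that(1) by (auto simp: T_def)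
        ultimately have "(j, \<sigma> x) \<in> r"
          using top[of x] W(1) by (auto simp: top_def)
        then have "(m, \<sigma> x) \<in> r" using that(2) ord(2) by (meson transD)
        moreover have "(\<sigma> x, m) \<in> r" using m(2) W(3) x by blast
        ultimately have "\<sigma> x = \<sigma> y" using ord(3) y(2) by (auto dest: antisymD)
        then show False using W(2) x y(1) by (auto dest: inj_onD)
      qed
      have "m \<in> J" using m(1) \<open>A \<subseteq> J\<close> by blast
      then have mm: "(m, m) \<in> r" using ord(1) by (meson refl_onD)
      have lead: "coord (y + \<Sum>T) m = coord y m"
        using small mm by (simp add: lookup_add lookup_sum)
      have topy: "top y m" using top y W(1) by blast
      have "(j, m) \<in> r" if "coord (y + \<Sum>T) j \<noteq> 0" for j
      proof -
        have "\<exists>x\<in>W. coord x j \<noteq> 0"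
        proof (rule ccontr)
          assume "\<not> ?thesis"
          then show False using that y(1) by (simp add: lookup_add lookup_sum T_def)
        qed
        then obtain x where "x \<in> W" "(j, \<sigma> x) \<in> r"
          using top W(1) by (auto simp: top_def)
        moreover have "(\<sigma> x, m) \<in> r" using \<open>x \<in> W\<close> m(2) W(3) by blast
        ultimately show ?thesis using ord(2) by (meson transD)
      qed
      then have topsum: "top (y + \<Sum>T) m"
        using lead topy by (auto simp: top_def)
      have "y + \<Sum>T \<in> FS k Y"
        using W(1) fW cW y(1) k by (intro add_sum_in_FS) (auto simp: T_def)
      then have "c (y + \<Sum>T) = c (multiple k y)"
        using mono y(1) W(1) unfolding monochromatic_def by fastforce
      then have "bit (y + \<Sum>T) = bit (multiple k y)"
        using split_c top_nz topsum top_multiple[OF topy] by blast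
      moreover have "\<sigma> (y + \<Sum>T) = m" "\<sigma> (multiple k y) = m"
        using \<sigma>_eq topsum top_multiple[OF topy] by auto
      moreover define q where "q = \<bar>real_of_rat (coord y m)\<bar>"
      ultimately have "nat (\<lfloor>log (real k) q\<rfloor> mod 2) = nat (\<lfloor>log (real k) (real k * q)\<rfloor> mod 2)"
        by (simp add: bit_def lead lookup_multiple of_rat_mult abs_mult)
      moreover have "q > 0"
        using topy by (simp add: q_def top_def)
      \<comment> \<open>Multiplying by \<open>k\<close> raises the logarithm by exactly 1 and so
        flips the bit.\<close>
      then have "\<lfloor>log (real k) (real k * q)\<rfloor> = \<lfloor>log (real k) q\<rfloor> + 1"
        using k by (simp add: log_mult)
      ultimately have "\<lfloor>log (real k) q\<rfloor> mod 2 = (\<lfloor>log (real k) q\<rfloor> + 1) mod 2"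
        by simp
      then show False by presburger
    qed
  qed
  moreover have "c x < 2 * N" if x: "x \<in> rat_direct_sum J" for x
  proof (cases "x = 0")
    case False
    then obtain i where i: "top x i" using top_ex x by blast
    then have "d (\<sigma> x) x < N"
      using d[OF top_in[OF x i]] top_seg[OF i] \<sigma>_eq[OF i] by auto
    then show ?thesis using bit[of x] False by (simp add: c_def)
  qed (use N in \<open>simp add: c_def\<close>)
  ultimately show ?thesis
    unfolding good_def by blast
qed

text \<open>The order is the cardinal \<open>|J|\<close> itself: being an initial ordinal, its
  strict initial segments have smaller cardinality. The closed segment adds its endpoint, whence
  \<open>insert i S\<close>.\<close>

lemma good_card_step:
  fixes J :: "'a set"
  assumes k: "k \<ge> 2" and N: "N > 0"
    and small: "\<And>S i :: 'a. |S| <o |J| \<Longrightarrow> good k (insert i S) N"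
  shows "good k J (2 * N)"
proof (rule good_step[OF _ k N])
  show lin: "linear_order_on J |J|"
    using card_of_well_order_on by (auto simp: well_order_on_def)
  fix i assume "i \<in> J"
  then have "|underS |J| i| <o |J|"
    by (intro card_of_underS card_of_Card_order) (simp add: Field_card_of)
  moreover have "{j. (j, i) \<in> |J|} = insert i (underS |J| i)"
    using lin \<open>i \<in> J\<close> by (auto simp: underS_def order_on_defs refl_on_def)
  ultimately show "good k {j. (j, i) \<in> |J|} N"
    using small by simp
qed

section \<open>Cardinal bounds and the induction on n\<close>

lemma has_card_omega_infinite:
  fixes A :: "'a set"
  shows "has_card_omega n A \<Longrightarrow> infinite A"
proof (induction n arbitrary: A)
  case 0
  then show ?case
    using infinite_iff_natLeq_ordLeq ordIso_iff_ordLeq by auto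
next
  case (Suc n)
  then obtain B :: "'a set" where B: "infinite B" "|A| =o cardSuc |B|" by auto
  then have "|B| \<le>o |A|"
    by (meson cardSuc_ordLeq card_of_Card_order ordIso_symmetric ordLeq_ordIso_trans)
  then show ?case using B(1) card_of_ordLeq_infinite by blast
qed

lemma card_of_insert_ordLeq:
  assumes "|S| \<le>o |B|" "infinite B"
  shows "|insert i S| \<le>o |B|"
proof -
  have "|{i}| \<le>o |B|"
    using assms(2) by (intro card_of_singl_ordLeq) auto
  then have "|{i} \<union> S| \<le>o |B|"
    using assms by (intro card_of_Un_ordLeq_infinite_Field) (simp_all add: Field_card_of card_of_card_order_on)
  then show ?thesis by simp
qed

text \<open>Stated for every \<open>J\<close> of cardinality at most that of \<open>B\<close>, in a
  possibly different type, since the segments in the induction are only bounded in size. The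
  exponent is \<open>Suc n\<close> because passing from finite sets to \<omega> already takes one
  step.\<close>

lemma good_has_card_omega:
  fixes J :: "'a set" and B :: "'b set"
  assumes k: "k \<ge> 2"
  shows "has_card_omega n B \<Longrightarrow> |J| \<le>o |B| \<Longrightarrow> good k J (24 * 2 ^ Suc n)"
proof (induction n arbitrary: B J)
  case 0
  have "good k (insert i S) 24" if "|S| <o |J|" for S :: "'a set" and i
  proof -
    have "|S| <o natLeq"
      using ordLess_ordLeq_trans[OF that ordLeq_ordIso_trans[OF 0(2)]] 0(1) by simp
    then show ?thesis
      by (intro good_finite k finite.insertI) (simp only: finite_iff_ordLess_natLeq)
  qed
  then have "good k J (2 * 24)" by (rule good_card_step[OF k zero_less_numeral])
  then show ?case by simp
next
  case (Suc n)
  then obtain C :: "'b set" where C: "has_card_omega n C" "|B| =o cardSuc |C|" by auto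
  have "good k (insert i S) (24 * 2 ^ Suc n)" if "|S| <o |J|" for S :: "'a set" and i
  proof -
    have "|S| <o cardSuc |C|"
      by (rule ordLess_ordLeq_trans[OF that ordLeq_ordIso_trans[OF Suc.prems(2) C(2)]])
    \<comment> \<open>Below the successor cardinal means at most the cardinal itself.\<close>
    then have "|S| \<le>o |C|"
      using cardSuc_ordLeq_ordLess[OF card_of_Card_order card_of_Card_order] by blast
    then have "|insert i S| \<le>o |C|"
      using has_card_omega_infinite[OF C(1)] by (rule card_of_insert_ordLeq)
    then show ?thesis by (rule Suc.IH[OF C(1)])
  qed
  moreover have "(24 * 2 ^ Suc n :: nat) > 0" by simp
  ultimately have "good k J (2 * (24 * 2 ^ Suc n))" by (intro good_card_step[OF k])
  then show ?case by simp
qed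

theorem theorem2p8:
  fixes k n :: nat and I :: "'a set"
  assumes "k \<ge> 2" and "has_card_omega n I"
  shows "\<exists>c \<in> rat_direct_sum I \<rightarrow> {..<(2 ^ (4 + n) * 3 ^ 2 :: nat)}.
    (\<nexists>X. X \<subseteq> rat_direct_sum I \<and> infinite X \<and> monochromatic c (FS k X \<union> multiple k ` X)) \<and>
    (\<nexists>X. X \<subseteq> rat_direct_sum I \<and> infinite X \<and> monochromatic c (sumset k X))"
proof -
  have "good k I (24 * 2 ^ Suc n)"
    by (intro good_has_card_omega[OF assms] ordIso_imp_ordLeq card_of_refl)
  \<comment> \<open>The colours used number 24 * 2^(n+1) = 3 * 2^(4+n), a third of those
    allowed.\<close>
  then have "good k I (2 ^ (4 + n) * 3 ^ 2)"
    by (rule good_mono) (simp add: power_add)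
  then obtain c where c: "c \<in> rat_direct_sum I \<rightarrow> {..<(2 ^ (4 + n) * 3 ^ 2 :: nat)}"
    "\<And>X. X \<subseteq> rat_direct_sum I \<Longrightarrow> infinite X \<Longrightarrow> \<not> monochromatic c (FS k X \<union> multiple k ` X)"
    unfolding good_def by blast
  moreover have "\<not> monochromatic c (sumset k X)"
    if "X \<subseteq> rat_direct_sum I" "infinite X" for X
  proof
    assume "monochromatic c (sumset k X)"
    then have "monochromatic c (FS k X \<union> multiple k ` X)"
      by (rule monochromatic_subset) (intro Un_least FS_subset_sumset multiple_subset_sumset)
    then show False using c(2)[OF that] by blast
  qed
  ultimately show ?thesis by (intro bexI[of _ c]) blast+
qed

end
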